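(* Let $1<p<\infty$, let $m$ be a positive integer and let $a_1,\dots,a_m$ be real numbers. Define $Q_m:l_p\times l_p\to l_p$ by $$Q_m(x,y)=\left\{\sum_{i=1}^ma_i(t_n^2+s_n)^i\right\}_{n=1}^\infty\quad\text{for } x=\{t_n\}_{n=1}^\infty,\ y=\{s_n\}_{n=1}^\infty\in l_p.$$ Then $Q_m$ is partially Fréchet differentiable on $l_p\times l_p$ with respect to each variable, and for any $(\bar x,\bar y)\in l_p\times l_p$ with $\bar x=(\bar t_1,\bar t_2,\dots)$ and $\bar y=(\bar s_1,\bar s_2,\dots)$: (i) the partial Fréchet derivative with respect to the first variable, $\nabla_1(Q_m)(\bar x,\bar y):l_p\to l_p$, is $$\nabla_1(Q_m)(\bar x,\bar y)=2\begin{pmatrix}\sum_{i=1}^ma_i\,i\,\bar t_1(\bar t_1^2+\bar s_1)^{i-1}&0&\cdots\\0&\sum_{i=1}^ma_i\,i\,\bar t_2(\bar t_2^2+\bar s_2)^{i-1}&0\\\vdots&0&\ddots\end{pmatrix};$$ (ii) the partial Fréchet derivative with respect to the second variable, $\nabla_2(Q_m)(\bar x,\bar y):l_p\to l_p$, is $$\nabla_2(Q_m)(\bar x,\bar y)=\begin{pmatrix}\sum_{i=1}^mi\,a_i(\bar t_1^2+\bar s_1)^{i-1}&0&\cdots\\0&\sum_{i=1}^mi\,a_i(\bar t_2^2+\bar s_2)^{i-1}&0\\\vdots&0&\ddots\end{pmatrix}.$$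
   Context: $l_p$ is the real sequence space with norm $\|\cdot\|_p$ and null element $\theta=(0,0,\dots)$. For $i=1$ the expression $(\cdot)^{i-1}$ equals $1$. A diagonal matrix with entries $d_n$ denotes the pointwise multiplication operator $\{t_n\}\mapsto\{d_nt_n\}$ on $l_p$. $F:l_p\times l_p\to l_p$ is partially Fréchet differentiable with respect to the first variable at $(\bar x,\bar y)$ if there is a continuous linear mapping $\nabla_1F(\bar x,\bar y):l_p\to l_p$ with $\lim_{u\to\theta}\frac{F(\bar x+u,\bar y)-F(\bar x,\bar y)-\nabla_1F(\bar x,\bar y)(u)}{\|u\|_p}=\theta$; with respect to the second variable if there is a continuous linear mapping $\nabla_2F(\bar x,\bar y):l_p\to l_p$ with $\lim_{w\to\theta}\frac{F(\bar x,\bar y+w)-F(\bar x,\bar y)-\nabla_2F(\bar x,\bar y)(w)}{\|w\|_p}=\theta$. *)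

theory Defs
  imports Complex_Main "HOL-Library.FuncSet"
begin

text \<open>
  The exponent of \<open>l\<^sub>p\<close> is an arbitrary real number and hence cannot be turned into a type
  parameter, so \<open>l\<^sub>p\<close> is a carrier set of real sequences.  Sequences are indexed from \<open>0\<close>:
  \<open>x n\<close> is the entry usually written \<open>t\<^bsub>n+1\<^esub>\<close>.
\<close>

definition lp :: "real \<Rightarrow> (nat \<Rightarrow> real) set" where
  "lp p = {x. summable (\<lambda>n. \<bar>x n\<bar> powr p)}"

definition lp_norm :: "real \<Rightarrow> (nat \<Rightarrow> real) \<Rightarrow> real" where
  "lp_norm p x = (\<Sum>n. \<bar>x n\<bar> powr p) powr (1 / p)"

text \<open>
  Linear operators on \<open>l\<^sub>p\<close> are taken from the extensional function space \<open>lp p \<rightarrow>\<^sub>E lp p\<close>, so that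
  equality of operators is equality of HOL functions.
\<close>

definition lp_linear :: "real \<Rightarrow> ((nat \<Rightarrow> real) \<Rightarrow> nat \<Rightarrow> real) \<Rightarrow> bool" where
  "lp_linear p T \<longleftrightarrow> T \<in> lp p \<rightarrow>\<^sub>E lp p \<and>
     (\<forall>x\<in>lp p. \<forall>y\<in>lp p. T (\<lambda>n. x n + y n) = (\<lambda>n. T x n + T y n)) \<and>
     (\<forall>c. \<forall>x\<in>lp p. T (\<lambda>n. c * x n) = (\<lambda>n. c * T x n))"

definition lp_continuous :: "real \<Rightarrow> ((nat \<Rightarrow> real) \<Rightarrow> nat \<Rightarrow> real) \<Rightarrow> bool" where
  "lp_continuous p T \<longleftrightarrow>
     (\<forall>x\<in>lp p. \<forall>\<epsilon>>0. \<exists>\<delta>>0. \<forall>y\<in>lp p.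
        lp_norm p (\<lambda>n. y n - x n) < \<delta> \<longrightarrow> lp_norm p (\<lambda>n. T y n - T x n) < \<epsilon>)"

text \<open>
  \<open>G u \<rightarrow> \<theta>\<close> in \<open>l\<^sub>p\<close> as \<open>u \<rightarrow> \<theta>\<close>, \<open>u \<noteq> \<theta>\<close>.  The condition \<open>G u \<in> lp p\<close> is needed because
  \<open>lp_norm p\<close> is meaningless outside \<open>lp p\<close>.
\<close>

definition lp_tendsto_null :: "real \<Rightarrow> ((nat \<Rightarrow> real) \<Rightarrow> nat \<Rightarrow> real) \<Rightarrow> bool" where
  "lp_tendsto_null p G \<longleftrightarrow>
     (\<forall>\<epsilon>>0. \<exists>\<delta>>0. \<forall>u\<in>lp p. u \<noteq> (\<lambda>n. 0) \<and> lp_norm p u < \<delta> \<longrightarrow>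
        G u \<in> lp p \<and> lp_norm p (G u) < \<epsilon>)"

definition lp_has_partial1 ::
  "real \<Rightarrow> ((nat \<Rightarrow> real) \<Rightarrow> (nat \<Rightarrow> real) \<Rightarrow> nat \<Rightarrow> real) \<Rightarrow> (nat \<Rightarrow> real) \<Rightarrow> (nat \<Rightarrow> real) \<Rightarrow>
   ((nat \<Rightarrow> real) \<Rightarrow> nat \<Rightarrow> real) \<Rightarrow> bool" where
  "lp_has_partial1 p F x y T \<longleftrightarrow> lp_linear p T \<and> lp_continuous p T \<and>
     lp_tendsto_null p (\<lambda>u n. (F (\<lambda>k. x k + u k) y n - F x y n - T u n) / lp_norm p u)"

definition lp_has_partial2 ::
  "real \<Rightarrow> ((nat \<Rightarrow> real) \<Rightarrow> (nat \<Rightarrow> real) \<Rightarrow> nat \<Rightarrow> real) \<Rightarrow> (nat \<Rightarrow> real) \<Rightarrow> (nat \<Rightarrow> real) \<Rightarrow>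
   ((nat \<Rightarrow> real) \<Rightarrow> nat \<Rightarrow> real) \<Rightarrow> bool" where
  "lp_has_partial2 p F x y T \<longleftrightarrow> lp_linear p T \<and> lp_continuous p T \<and>
     lp_tendsto_null p (\<lambda>w n. (F x (\<lambda>k. y k + w k) n - F x y n - T w n) / lp_norm p w)"

definition lp_partial1_differentiable ::
  "real \<Rightarrow> ((nat \<Rightarrow> real) \<Rightarrow> (nat \<Rightarrow> real) \<Rightarrow> nat \<Rightarrow> real) \<Rightarrow> (nat \<Rightarrow> real) \<Rightarrow> (nat \<Rightarrow> real) \<Rightarrow> bool" where
  "lp_partial1_differentiable p F x y \<longleftrightarrow> (\<exists>T. lp_has_partial1 p F x y T)"

definition lp_partial2_differentiable ::
  "real \<Rightarrow> ((nat \<Rightarrow> real) \<Rightarrow> (nat \<Rightarrow> real) \<Rightarrow> nat \<Rightarrow> real) \<Rightarrow> (nat \<Rightarrow> real) \<Rightarrow> (nat \<Rightarrow> real) \<Rightarrow> bool" where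
  "lp_partial2_differentiable p F x y \<longleftrightarrow> (\<exists>T. lp_has_partial2 p F x y T)"

definition lp_nabla1 ::
  "real \<Rightarrow> ((nat \<Rightarrow> real) \<Rightarrow> (nat \<Rightarrow> real) \<Rightarrow> nat \<Rightarrow> real) \<Rightarrow> (nat \<Rightarrow> real) \<Rightarrow> (nat \<Rightarrow> real) \<Rightarrow>
   (nat \<Rightarrow> real) \<Rightarrow> nat \<Rightarrow> real" where
  "lp_nabla1 p F x y = (SOME T. lp_has_partial1 p F x y T)"

definition lp_nabla2 ::
  "real \<Rightarrow> ((nat \<Rightarrow> real) \<Rightarrow> (nat \<Rightarrow> real) \<Rightarrow> nat \<Rightarrow> real) \<Rightarrow> (nat \<Rightarrow> real) \<Rightarrow> (nat \<Rightarrow> real) \<Rightarrow>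
   (nat \<Rightarrow> real) \<Rightarrow> nat \<Rightarrow> real" where
  "lp_nabla2 p F x y = (SOME T. lp_has_partial2 p F x y T)"

definition lp_diag :: "real \<Rightarrow> (nat \<Rightarrow> real) \<Rightarrow> (nat \<Rightarrow> real) \<Rightarrow> nat \<Rightarrow> real" where
  "lp_diag p d = (\<lambda>t\<in>lp p. \<lambda>n. d n * t n)"

definition Q :: "nat \<Rightarrow> (nat \<Rightarrow> real) \<Rightarrow> (nat \<Rightarrow> real) \<Rightarrow> (nat \<Rightarrow> real) \<Rightarrow> nat \<Rightarrow> real" where
  "Q m a x y = (\<lambda>n. \<Sum>i=1..m. a i * ((x n)\<^sup>2 + y n) ^ i)"

end

theory Submission
  imports Defs
begin

text \<open>
  \<open>Q m a\<close> acts entrywise: its \<open>n\<close>-th entry is the polynomial \<open>P z = (\<Sum>i=1..m. a i * z ^ i)\<close> at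
  \<open>z = (x n)\<^sup>2 + y n\<close>.  Entries of a sequence in \<open>l\<^sub>p\<close> are bounded by its norm (\<open>abs_le_lp_norm\<close>), so
  for fixed \<open>x\<close>, \<open>y\<close> all these \<open>z\<close> lie in one bounded interval.  There \<open>P\<close> has a second-order Taylor
  estimate with one constant \<open>C\<close> (\<open>polynomial_quadratic_remainder\<close>), hence a perturbation \<open>u\<close> of norm
  at most \<open>1\<close> changes the \<open>n\<close>-th entry by \<open>d n * u n\<close> up to an error of at most \<open>C * (u n)\<^sup>2\<close>, where
  \<open>d\<close> is the sequence of entrywise derivatives and \<open>C\<close> does not depend on \<open>n\<close>.

  Such an error is negligible in \<open>l\<^sub>p\<close>: since \<open>\<bar>u n\<bar> \<le> \<parallel>u\<parallel>\<close>, the error divided by \<open>\<parallel>u\<parallel>\<close> is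
  dominated entrywise by \<open>C * \<bar>u n\<bar>\<close>, so its norm is at most \<open>C * \<parallel>u\<parallel>\<close>.  As \<open>d\<close> is bounded, the
  diagonal operator of \<open>d\<close> is continuous on \<open>l\<^sub>p\<close>, and it is a derivative
  (\<open>lp_diag_has_derivative\<close>).

  The operators \<open>lp_nabla1\<close> and \<open>lp_nabla2\<close> are chosen among all derivatives, so identifying them also
  takes uniqueness (\<open>lp_has_derivative_unique\<close>).  Each single entry, followed along a ray, already
  determines the derivative.
\<close>

section \<open>The sequence space\<close>

lemma lp_norm_nonneg: "0 \<le> lp_norm p x"
  by (simp add: lp_norm_def)

lemma lp_dominated:
  assumes p: "0 < p" and y: "y \<in> lp p" and C: "0 \<le> C" and le: "\<And>n. \<bar>x n\<bar> \<le> C * \<bar>y n\<bar>"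
  shows "x \<in> lp p" and "lp_norm p x \<le> C * lp_norm p y"
proof -
  have sy: "summable (\<lambda>n. \<bar>y n\<bar> powr p)"
    using y by (simp add: lp_def)
  have le': "\<bar>x n\<bar> powr p \<le> C powr p * \<bar>y n\<bar> powr p" for n
    using powr_mono2[OF less_imp_le[OF p] abs_ge_zero le[of n]] C by (simp add: powr_mult)
  have sx: "summable (\<lambda>n. \<bar>x n\<bar> powr p)"
    by (rule summable_comparison_test'[OF summable_mult[OF sy, of "C powr p"], of 0])
       (use le' in auto)
  then show "x \<in> lp p"
    by (simp add: lp_def)
  have "(\<Sum>n. \<bar>x n\<bar> powr p) \<le> C powr p * (\<Sum>n. \<bar>y n\<bar> powr p)"
    using suminf_le[OF le' sx summable_mult[OF sy]] suminf_mult[OF sy] by simp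
  then have "lp_norm p x \<le> (C powr p * (\<Sum>n. \<bar>y n\<bar> powr p)) powr (1 / p)"
    unfolding lp_norm_def using p suminf_nonneg[OF sx] by (intro powr_mono2) auto
  also have "\<dots> = C * lp_norm p y"
    unfolding lp_norm_def using p C suminf_nonneg[OF sy] by (simp add: powr_mult powr_powr)
  finally show "lp_norm p x \<le> C * lp_norm p y" .
qed

lemma lp_scale:
  assumes "0 < p" and "x \<in> lp p"
  shows "(\<lambda>n. c * x n) \<in> lp p" and "lp_norm p (\<lambda>n. c * x n) \<le> \<bar>c\<bar> * lp_norm p x"
  using lp_dominated[of p x "\<bar>c\<bar>" "\<lambda>n. c * x n"] assms by (auto simp: abs_mult)

text \<open>
  The sum is dominated by \<open>2 * max \<bar>x n\<bar> \<bar>y n\<bar>\<close>, and the maximum is \<open>p\<close>-summable because its \<open>p\<close>-th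
  power is one of the two summable terms.
\<close>

lemma lp_add:
  assumes p: "0 < p" and "x \<in> lp p" and "y \<in> lp p"
  shows "(\<lambda>n. x n + y n) \<in> lp p"
proof -
  have "summable (\<lambda>n. \<bar>x n\<bar> powr p + \<bar>y n\<bar> powr p)"
    using assms by (intro summable_add) (auto simp: lp_def)
  then have "summable (\<lambda>n. \<bar>max \<bar>x n\<bar> \<bar>y n\<bar>\<bar> powr p)"
    by (rule summable_comparison_test'[where N = 0]) (auto simp: max_def)
  then have "(\<lambda>n. max \<bar>x n\<bar> \<bar>y n\<bar>) \<in> lp p"
    by (simp add: lp_def)
  then show ?thesis
    by (rule lp_dominated(1)[OF p, of _ 2]) (auto simp: max_def)
qed

lemma lp_diff:
  assumes "0 < p" and "x \<in> lp p" and "y \<in> lp p"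
  shows "(\<lambda>n. x n - y n) \<in> lp p"
  using lp_add[OF assms(1,2) lp_scale(1)[OF assms(1,3), of "-1"]] by simp

lemma abs_le_lp_norm:
  assumes p: "0 < p" and x: "x \<in> lp p"
  shows "\<bar>x n\<bar> \<le> lp_norm p x"
proof -
  have "(\<Sum>k\<in>{n}. \<bar>x k\<bar> powr p) \<le> (\<Sum>k. \<bar>x k\<bar> powr p)"
    using x by (intro sum_le_suminf) (auto simp: lp_def)
  then have "(\<bar>x n\<bar> powr p) powr (1 / p) \<le> lp_norm p x"
    unfolding lp_norm_def using p by (intro powr_mono2) auto
  then show ?thesis
    using p by (simp add: powr_powr)
qed

lemma lp_norm_pos:
  assumes "0 < p" and "x \<in> lp p" and "x \<noteq> (\<lambda>n. 0)"
  shows "0 < lp_norm p x"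
proof -
  obtain n where "x n \<noteq> 0"
    using assms(3) by auto
  then show ?thesis
    using abs_le_lp_norm[OF assms(1,2), of n] by linarith
qed

section \<open>Derivatives on the sequence space\<close>

text \<open>
  Here \<open>G u\<close> is the increment \<open>F (x + u) - F x\<close> of the function to be differentiated.  Working with
  increments makes the two partial derivatives instances of one notion.
\<close>

definition lp_has_derivative ::
  "real \<Rightarrow> ((nat \<Rightarrow> real) \<Rightarrow> nat \<Rightarrow> real) \<Rightarrow> ((nat \<Rightarrow> real) \<Rightarrow> nat \<Rightarrow> real) \<Rightarrow> bool" where
  "lp_has_derivative p G T \<longleftrightarrow> lp_linear p T \<and> lp_continuous p T \<and>
     lp_tendsto_null p (\<lambda>u n. (G u n - T u n) / lp_norm p u)"

lemma lp_has_partial1_iff: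
  "lp_has_partial1 p F x y T \<longleftrightarrow>
     lp_has_derivative p (\<lambda>u n. F (\<lambda>k. x k + u k) y n - F x y n) T"
  by (simp add: lp_has_partial1_def lp_has_derivative_def)

lemma lp_has_partial2_iff:
  "lp_has_partial2 p F x y T \<longleftrightarrow>
     lp_has_derivative p (\<lambda>w n. F x (\<lambda>k. y k + w k) n - F x y n) T"
  by (simp add: lp_has_partial2_def lp_has_derivative_def)

text \<open>
  Since an entry is bounded by the norm, convergence in \<open>l\<^sub>p\<close> gives a first-order estimate for each
  real-valued entry, uniformly in \<open>n\<close>.
\<close>

lemma lp_has_derivative_entry:
  assumes p: "0 < p" and T: "lp_has_derivative p G T" and e: "0 < \<epsilon>"
  obtains \<delta> where "0 < \<delta>" and "\<And>u n. u \<in> lp p \<Longrightarrow> u \<noteq> (\<lambda>n. 0) \<Longrightarrow> lp_norm p u < \<delta> \<Longrightarrow>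
    \<bar>G u n - T u n\<bar> \<le> \<epsilon> * lp_norm p u"
proof -
  have "lp_tendsto_null p (\<lambda>u n. (G u n - T u n) / lp_norm p u)"
    using T by (simp add: lp_has_derivative_def)
  then obtain \<delta> where d: "0 < \<delta>" "\<forall>u\<in>lp p. u \<noteq> (\<lambda>n. 0) \<and> lp_norm p u < \<delta> \<longrightarrow>
      (\<lambda>n. (G u n - T u n) / lp_norm p u) \<in> lp p \<and>
      lp_norm p (\<lambda>n. (G u n - T u n) / lp_norm p u) < \<epsilon>"
    unfolding lp_tendsto_null_def using e by blast
  show ?thesis
  proof (rule that[OF d(1)])
    fix u n assume u: "u \<in> lp p" "u \<noteq> (\<lambda>n. 0)" "lp_norm p u < \<delta>"
    have "(\<lambda>n. (G u n - T u n) / lp_norm p u) \<in> lp p"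
      and less: "lp_norm p (\<lambda>n. (G u n - T u n) / lp_norm p u) < \<epsilon>"
      using d(2) u by blast+
    then have "\<bar>(G u n - T u n) / lp_norm p u\<bar> < \<epsilon>"
      using abs_le_lp_norm[OF p, of _ n] by fastforce
    then show "\<bar>G u n - T u n\<bar> \<le> \<epsilon> * lp_norm p u"
      using lp_norm_pos[OF p u(1,2)] by (simp add: abs_divide divide_less_eq)
  qed
qed

text \<open>
  Two derivatives \<open>T\<close>, \<open>S\<close> of \<open>G\<close> satisfy \<open>\<bar>T u n - S u n\<bar> \<le> 2 * \<epsilon> * \<parallel>u\<parallel>\<close> for all small \<open>u\<close>.  For \<open>u = s * v\<close> the factor \<open>s\<close> cancels by linearity, so the estimate
  holds at every \<open>v\<close> and for every \<open>\<epsilon>\<close>.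
\<close>

lemma lp_has_derivative_unique:
  assumes p: "0 < p" and T: "lp_has_derivative p G T" and S: "lp_has_derivative p G S"
  shows "T = S"
proof (rule extensionalityI[of _ "lp p"])
  show "T \<in> extensional (lp p)" "S \<in> extensional (lp p)"
    using T S by (auto simp: lp_has_derivative_def lp_linear_def PiE_def)
next
  fix v assume v: "v \<in> lp p"
  have hom: "T (\<lambda>n. c * v n) = (\<lambda>n. c * T v n)" "S (\<lambda>n. c * v n) = (\<lambda>n. c * S v n)" for c
    using T S v by (auto simp: lp_has_derivative_def lp_linear_def)
  show "T v = S v"
  proof (cases "v = (\<lambda>n. 0)")
    case True
    then show ?thesis
      using hom[of 0] by simp
  next
    case False
    define V where "V = lp_norm p v"
    have V: "0 < V"
      unfolding V_def by (rule lp_norm_pos[OF p v False])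
    have close: "\<bar>T v n - S v n\<bar> \<le> 2 * \<epsilon> * V" if e: "0 < \<epsilon>" for n \<epsilon>
    proof -
      obtain d1 where d1: "0 < d1" "\<And>u n. u \<in> lp p \<Longrightarrow> u \<noteq> (\<lambda>n. 0) \<Longrightarrow> lp_norm p u < d1 \<Longrightarrow>
          \<bar>G u n - T u n\<bar> \<le> \<epsilon> * lp_norm p u"
        using lp_has_derivative_entry[OF p T e] by blast
      obtain d2 where d2: "0 < d2" "\<And>u n. u \<in> lp p \<Longrightarrow> u \<noteq> (\<lambda>n. 0) \<Longrightarrow> lp_norm p u < d2 \<Longrightarrow>
          \<bar>G u n - S u n\<bar> \<le> \<epsilon> * lp_norm p u"
        using lp_has_derivative_entry[OF p S e] by blast
      \<comment> \<open>half the length at which \<open>s * v\<close> could leave one of the two neighbourhoods\<close>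
      define s where "s = min d1 d2 / (2 * V)"
      have s: "0 < s" "s * V < d1" "s * V < d2"
        using V d1(1) d2(1) by (auto simp: s_def field_simps min_def)
      define u where "u = (\<lambda>n. s * v n)"
      have u: "u \<in> lp p" "lp_norm p u \<le> s * V"
        using lp_scale[OF p v, of s] s(1) by (auto simp: u_def V_def)
      have u0: "u \<noteq> (\<lambda>n. 0)"
        using False s(1) by (auto simp: u_def fun_eq_iff)
      have "\<bar>G u n - T u n\<bar> \<le> \<epsilon> * lp_norm p u" "\<bar>G u n - S u n\<bar> \<le> \<epsilon> * lp_norm p u"
        using d1(2)[OF u(1) u0] d2(2)[OF u(1) u0] u(2) s by auto
      then have "\<bar>T u n - S u n\<bar> \<le> 2 * \<epsilon> * lp_norm p u"
        by linarith
      also have "\<dots> \<le> 2 * \<epsilon> * (s * V)"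
        using u(2) e by (intro mult_left_mono) auto
      also have "T u n - S u n = s * (T v n - S v n)"
        unfolding u_def hom by (simp add: algebra_simps)
      finally have "s * \<bar>T v n - S v n\<bar> \<le> s * (2 * \<epsilon> * V)"
        using s(1) by (simp add: abs_mult mult_ac)
      then show ?thesis
        using s(1) by simp
    qed
    show ?thesis
    proof
      fix n
      have "\<bar>T v n - S v n\<bar> \<le> 0"
      proof (rule field_le_epsilon)
        fix e :: real assume "0 < e"
        then show "\<bar>T v n - S v n\<bar> \<le> 0 + e"
          using close[of "e / (2 * V)" n] V by (simp add: field_simps)
      qed
      then show "T v n = S v n"
        by simp
    qed
  qed
qed

lemma lp_diag_apply: "x \<in> lp p \<Longrightarrow> lp_diag p d x = (\<lambda>n. d n * x n)"
  by (simp add: lp_diag_def)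

lemma lp_diag_linear:
  assumes p: "0 < p" and d: "\<And>n. \<bar>d n\<bar> \<le> K"
  shows "lp_linear p (lp_diag p d)"
proof -
  have "0 \<le> K"
    using d[of 0] by linarith
  then have "(\<lambda>n. d n * x n) \<in> lp p" if "x \<in> lp p" for x
    using lp_dominated(1)[OF p that, of K "\<lambda>n. d n * x n"] d
    by (simp add: abs_mult mult_right_mono)
  then have "lp_diag p d \<in> lp p \<rightarrow>\<^sub>E lp p"
    by (simp add: lp_diag_def)
  then show ?thesis
    by (auto simp: lp_linear_def lp_diag_apply lp_add[OF p] lp_scale[OF p] algebra_simps)
qed

lemma lp_diag_continuous:
  assumes p: "0 < p" and d: "\<And>n. \<bar>d n\<bar> \<le> K"
  shows "lp_continuous p (lp_diag p d)"
  unfolding lp_continuous_def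
proof (intro ballI allI impI)
  fix x and \<epsilon> :: real assume x: "x \<in> lp p" and e: "0 < \<epsilon>"
  have K: "0 \<le> K"
    using d[of 0] by linarith
  \<comment> \<open>\<open>K\<close> may be \<open>0\<close>, hence the denominator \<open>K + 1\<close>.\<close>
  show "\<exists>\<delta>>0. \<forall>y\<in>lp p. lp_norm p (\<lambda>n. y n - x n) < \<delta> \<longrightarrow>
      lp_norm p (\<lambda>n. lp_diag p d y n - lp_diag p d x n) < \<epsilon>"
  proof (intro exI[of _ "\<epsilon> / (K + 1)"] conjI ballI impI)
    show "0 < \<epsilon> / (K + 1)"
      using e K by simp
    fix y assume y: "y \<in> lp p" and less: "lp_norm p (\<lambda>n. y n - x n) < \<epsilon> / (K + 1)"
    have "\<bar>lp_diag p d y n - lp_diag p d x n\<bar> \<le> K * \<bar>y n - x n\<bar>" for n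
      using x y d[of n]
      by (simp add: lp_diag_apply abs_mult mult_right_mono flip: right_diff_distrib)
    then have "lp_norm p (\<lambda>n. lp_diag p d y n - lp_diag p d x n) \<le> K * lp_norm p (\<lambda>n. y n - x n)"
      by (rule lp_dominated(2)[OF p lp_diff[OF p y x] K])
    also have "\<dots> \<le> (K + 1) * lp_norm p (\<lambda>n. y n - x n)"
      by (intro mult_right_mono) (auto simp: lp_norm_nonneg)
    also have "\<dots> < \<epsilon>"
      using less K by (simp add: field_simps)
    finally show "lp_norm p (\<lambda>n. lp_diag p d y n - lp_diag p d x n) < \<epsilon>" .
  qed
qed

text \<open>
  One factor of \<open>(u n)\<^sup>2\<close> is absorbed by \<open>\<parallel>u\<parallel>\<close>, the other keeps the quotient in \<open>l\<^sub>p\<close> and makes its norm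
  at most \<open>C * \<parallel>u\<parallel>\<close>.
\<close>

lemma lp_diag_has_derivative:
  assumes p: "0 < p" and d: "\<And>n. \<bar>d n\<bar> \<le> K"
    and G: "\<And>u n. \<bar>u n\<bar> \<le> 1 \<Longrightarrow> \<bar>G u n - d n * u n\<bar> \<le> C * (u n)\<^sup>2" and C: "0 \<le> C"
  shows "lp_has_derivative p G (lp_diag p d)"
  unfolding lp_has_derivative_def
proof (intro conjI)
  show "lp_linear p (lp_diag p d)" "lp_continuous p (lp_diag p d)"
    using lp_diag_linear[OF p] lp_diag_continuous[OF p] d by blast+
  show "lp_tendsto_null p (\<lambda>u n. (G u n - lp_diag p d u n) / lp_norm p u)"
    unfolding lp_tendsto_null_def
  proof (intro allI impI)
    fix \<epsilon> :: real assume e: "0 < \<epsilon>"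
    \<comment> \<open>The bound \<open>1\<close> on \<open>\<parallel>u\<parallel>\<close> makes \<open>G\<close> applicable; \<open>\<epsilon> / (C + 1)\<close> makes \<open>C * \<parallel>u\<parallel> < \<epsilon>\<close> even if \<open>C = 0\<close>.\<close>
    show "\<exists>\<delta>>0. \<forall>u\<in>lp p. u \<noteq> (\<lambda>n. 0) \<and> lp_norm p u < \<delta> \<longrightarrow>
        (\<lambda>n. (G u n - lp_diag p d u n) / lp_norm p u) \<in> lp p \<and>
        lp_norm p (\<lambda>n. (G u n - lp_diag p d u n) / lp_norm p u) < \<epsilon>"
    proof (intro exI[of _ "min 1 (\<epsilon> / (C + 1))"] conjI ballI impI)
      show "0 < min 1 (\<epsilon> / (C + 1))"
        using e C by simp
      fix u assume u: "u \<in> lp p"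
        and small: "u \<noteq> (\<lambda>n. 0) \<and> lp_norm p u < min 1 (\<epsilon> / (C + 1))"
      have U: "0 < lp_norm p u"
        using lp_norm_pos[OF p u] small by blast
      have quot: "\<bar>(G u n - lp_diag p d u n) / lp_norm p u\<bar> \<le> C * \<bar>u n\<bar>" for n
      proof -
        have un: "\<bar>u n\<bar> \<le> lp_norm p u"
          by (rule abs_le_lp_norm[OF p u])
        then have "\<bar>G u n - d n * u n\<bar> \<le> C * (u n)\<^sup>2"
          using G[of u n] small by simp
        also have "\<dots> = C * \<bar>u n\<bar> * \<bar>u n\<bar>"
          by (simp add: power2_eq_square)
        also have "\<dots> \<le> C * \<bar>u n\<bar> * lp_norm p u"
          using un C by (intro mult_left_mono) auto
        finally show ?thesis
          using U u by (simp add: lp_diag_apply abs_divide divide_le_eq)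
      qed
      show "(\<lambda>n. (G u n - lp_diag p d u n) / lp_norm p u) \<in> lp p"
        by (rule lp_dominated(1)[OF p u C quot])
      have "lp_norm p (\<lambda>n. (G u n - lp_diag p d u n) / lp_norm p u) \<le> C * lp_norm p u"
        by (rule lp_dominated(2)[OF p u C quot])
      also have "\<dots> \<le> (C + 1) * lp_norm p u"
        by (intro mult_right_mono) (auto simp: lp_norm_nonneg)
      also have "\<dots> < \<epsilon>"
        using small C by (simp add: field_simps)
      finally show "lp_norm p (\<lambda>n. (G u n - lp_diag p d u n) / lp_norm p u) < \<epsilon>" .
    qed
  qed
qed

lemma lp_nabla1_eqI:
  assumes "0 < p" and T: "lp_has_partial1 p F x y T"
  shows "lp_nabla1 p F x y = T"
  unfolding lp_nabla1_def
proof (rule some_equality)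
  show "lp_has_partial1 p F x y T"
    by (rule T)
  show "S = T" if "lp_has_partial1 p F x y S" for S
    using lp_has_derivative_unique that assms unfolding lp_has_partial1_iff by blast
qed

lemma lp_nabla2_eqI:
  assumes "0 < p" and T: "lp_has_partial2 p F x y T"
  shows "lp_nabla2 p F x y = T"
  unfolding lp_nabla2_def
proof (rule some_equality)
  show "lp_has_partial2 p F x y T"
    by (rule T)
  show "S = T" if "lp_has_partial2 p F x y S" for S
    using lp_has_derivative_unique that assms unfolding lp_has_partial2_iff by blast
qed

section \<open>Polynomials on a bounded interval\<close>

lemma polynomial_bounded:
  fixes a :: "nat \<Rightarrow> real"
  assumes "\<bar>z\<bar> \<le> M"
  shows "\<bar>\<Sum>i\<in>I. a i * z ^ e i\<bar> \<le> (\<Sum>i\<in>I. \<bar>a i\<bar> * M ^ e i)"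
proof -
  have "\<bar>\<Sum>i\<in>I. a i * z ^ e i\<bar> \<le> (\<Sum>i\<in>I. \<bar>a i * z ^ e i\<bar>)"
    by (rule sum_abs)
  also have "\<dots> \<le> (\<Sum>i\<in>I. \<bar>a i\<bar> * M ^ e i)"
    using assms by (intro sum_mono) (auto simp: abs_mult power_abs intro!: mult_left_mono power_mono)
  finally show ?thesis .
qed

text \<open>
  Induction on \<open>i\<close>: the remainder \<open>r\<^sub>i = (z + h) ^ i - z ^ i - i * z ^ (i - 1) * h\<close> satisfies \<open>r\<^bsub>i+1\<^esub> = (z + h) * r\<^sub>i + i * z ^ (i - 1) * h\<^sup>2\<close>.
\<close>

lemma power_quadratic_remainder:
  fixes M :: real
  shows "\<exists>C\<ge>0. \<forall>z h. \<bar>z\<bar> \<le> M \<longrightarrow> \<bar>h\<bar> \<le> M \<longrightarrow>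
    \<bar>(z + h) ^ i - z ^ i - real i * z ^ (i - 1) * h\<bar> \<le> C * h\<^sup>2"
proof (cases "0 \<le> M")
  case False
  then show ?thesis
    by (intro exI[of _ 0]) auto
next
  case M: True
  show ?thesis
  proof (induction i)
    case 0
    show ?case
      by (intro exI[of _ 0]) auto
  next
    case (Suc i)
    then obtain C where C: "0 \<le> C" "\<And>z h. \<bar>z\<bar> \<le> M \<Longrightarrow> \<bar>h\<bar> \<le> M \<Longrightarrow>
        \<bar>(z + h) ^ i - z ^ i - real i * z ^ (i - 1) * h\<bar> \<le> C * h\<^sup>2"
      by blast
    show ?case
    proof (intro exI[of _ "2 * M * C + real i * M ^ (i - 1)"] conjI allI impI)
      show "0 \<le> 2 * M * C + real i * M ^ (i - 1)"
        using M C(1) by simp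
      fix z h :: real assume z: "\<bar>z\<bar> \<le> M" and h: "\<bar>h\<bar> \<le> M"
      define r where "r = (z + h) ^ i - z ^ i - real i * z ^ (i - 1) * h"
      have zi: "real i * z ^ i = real i * z ^ (i - 1) * z"
        by (cases i) auto
      have "(z + h) ^ Suc i - z ^ Suc i - real (Suc i) * z ^ (Suc i - 1) * h
          = (z + h) * ((z + h) ^ i - z ^ i) - real i * z ^ i * h"
        by (simp add: algebra_simps)
      also have "\<dots> = (z + h) * r + real i * z ^ (i - 1) * h\<^sup>2"
        unfolding zi r_def by (simp add: algebra_simps power2_eq_square)
      finally have "\<bar>(z + h) ^ Suc i - z ^ Suc i - real (Suc i) * z ^ (Suc i - 1) * h\<bar>
          \<le> \<bar>z + h\<bar> * \<bar>r\<bar> + real i * \<bar>z\<bar> ^ (i - 1) * h\<^sup>2"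
        using abs_triangle_ineq[of "(z + h) * r" "real i * z ^ (i - 1) * h\<^sup>2"]
        by (simp add: abs_mult power_abs)
      also have "\<dots> \<le> (2 * M) * (C * h\<^sup>2) + real i * M ^ (i - 1) * h\<^sup>2"
      proof (rule add_mono)
        show "\<bar>z + h\<bar> * \<bar>r\<bar> \<le> (2 * M) * (C * h\<^sup>2)"
          using z h M C(2)[OF z h] by (intro mult_mono) (auto simp: r_def)
        show "real i * \<bar>z\<bar> ^ (i - 1) * h\<^sup>2 \<le> real i * M ^ (i - 1) * h\<^sup>2"
          using z by (intro mult_right_mono mult_left_mono power_mono) auto
      qed
      finally show "\<bar>(z + h) ^ Suc i - z ^ Suc i - real (Suc i) * z ^ (Suc i - 1) * h\<bar>
          \<le> (2 * M * C + real i * M ^ (i - 1)) * h\<^sup>2"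
        by (simp add: algebra_simps)
    qed
  qed
qed

lemma polynomial_quadratic_remainder:
  fixes a :: "nat \<Rightarrow> real" and M :: real
  obtains C where "0 \<le> C" and "\<And>z h. \<bar>z\<bar> \<le> M \<Longrightarrow> \<bar>h\<bar> \<le> M \<Longrightarrow>
    \<bar>(\<Sum>i\<in>I. a i * (z + h) ^ i) - (\<Sum>i\<in>I. a i * z ^ i)
      - (\<Sum>i\<in>I. real i * a i * z ^ (i - 1)) * h\<bar> \<le> C * h\<^sup>2"
proof -
  obtain C where C: "\<And>i. 0 \<le> C i" "\<And>i z h. \<bar>z\<bar> \<le> M \<Longrightarrow> \<bar>h\<bar> \<le> M \<Longrightarrow>
      \<bar>(z + h) ^ i - z ^ i - real i * z ^ (i - 1) * h\<bar> \<le> C i * h\<^sup>2"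
    using power_quadratic_remainder[of M] by metis
  show ?thesis
  proof (rule that[of "\<Sum>i\<in>I. \<bar>a i\<bar> * C i"])
    show "0 \<le> (\<Sum>i\<in>I. \<bar>a i\<bar> * C i)"
      using C(1) by (intro sum_nonneg) auto
    fix z h :: real assume z: "\<bar>z\<bar> \<le> M" and h: "\<bar>h\<bar> \<le> M"
    have "(\<Sum>i\<in>I. a i * (z + h) ^ i) - (\<Sum>i\<in>I. a i * z ^ i)
        - (\<Sum>i\<in>I. real i * a i * z ^ (i - 1)) * h
        = (\<Sum>i\<in>I. a i * ((z + h) ^ i - z ^ i - real i * z ^ (i - 1) * h))"
      unfolding sum_distrib_right sum_subtractf[symmetric] by (simp add: algebra_simps)
    also have "\<bar>\<dots>\<bar> \<le> (\<Sum>i\<in>I. \<bar>a i * ((z + h) ^ i - z ^ i - real i * z ^ (i - 1) * h)\<bar>)"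
      by (rule sum_abs)
    also have "\<dots> \<le> (\<Sum>i\<in>I. \<bar>a i\<bar> * (C i * h\<^sup>2))"
      unfolding abs_mult[of "a _"] using C(2)[OF z h] by (intro sum_mono mult_left_mono) auto
    finally show "\<bar>(\<Sum>i\<in>I. a i * (z + h) ^ i) - (\<Sum>i\<in>I. a i * z ^ i)
        - (\<Sum>i\<in>I. real i * a i * z ^ (i - 1)) * h\<bar> \<le> (\<Sum>i\<in>I. \<bar>a i\<bar> * C i) * h\<^sup>2"
      by (simp only: sum_distrib_right mult.assoc)
  qed
qed

section \<open>The polynomial mapping\<close>

lemma lp_square_add:
  assumes p: "0 < p" and x: "x \<in> lp p" and y: "y \<in> lp p"
  shows "(\<lambda>n. (x n)\<^sup>2 + y n) \<in> lp p"
proof (rule lp_add[OF p _ y])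
  show "(\<lambda>n. (x n)\<^sup>2) \<in> lp p"
  proof (rule lp_dominated(1)[OF p x lp_norm_nonneg])
    show "\<bar>(x n)\<^sup>2\<bar> \<le> lp_norm p x * \<bar>x n\<bar>" for n
      using mult_right_mono[OF abs_le_lp_norm[OF p x], of "\<bar>x n\<bar>" n]
      by (simp add: power2_eq_square abs_mult)
  qed
qed

text \<open>The polynomial has no constant term, so on a bounded interval it is at most a multiple of \<open>\<bar>z\<bar>\<close>.\<close>

lemma Q_in_lp:
  assumes p: "0 < p" and x: "x \<in> lp p" and y: "y \<in> lp p"
  shows "Q m a x y \<in> lp p"
proof -
  define z where "z = (\<lambda>n. (x n)\<^sup>2 + y n)"
  have z: "z \<in> lp p"
    unfolding z_def by (rule lp_square_add[OF assms])
  define K where "K = (\<Sum>i=1..m. \<bar>a i\<bar> * lp_norm p z ^ (i - 1))"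
  have K: "\<bar>\<Sum>i=1..m. a i * z n ^ (i - 1)\<bar> \<le> K" for n
    unfolding K_def by (rule polynomial_bounded[OF abs_le_lp_norm[OF p z]])
  have "Q m a x y n = (\<Sum>i=1..m. a i * z n ^ (i - 1)) * z n" for n
    unfolding Q_def sum_distrib_right z_def
    by (rule sum.cong) (auto simp: power_eq_if)
  then have "\<bar>Q m a x y n\<bar> \<le> K * \<bar>z n\<bar>" for n
    using K[of n] by (simp add: abs_mult mult_right_mono)
  moreover have "0 \<le> K"
    using K[of 0] by linarith
  ultimately show ?thesis
    using lp_dominated(1)[OF p z] by blast
qed

text \<open>
  Replacing \<open>t\<close> by \<open>t + u\<close> moves \<open>t\<^sup>2 + s\<close> by \<open>h = 2 * t * u + u\<^sup>2\<close>.  With \<open>\<bar>h\<bar> \<le> (2 * B + 1) * \<bar>u\<bar>\<close>, the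
  Taylor remainder at \<open>h\<close> and the term \<open>P' z * u\<^sup>2\<close> are both of order \<open>u\<^sup>2\<close>.
\<close>

lemma Q_has_partial1:
  assumes p: "0 < p" and x: "x \<in> lp p" and y: "y \<in> lp p"
  shows "lp_has_partial1 p (Q m a) x y
    (lp_diag p (\<lambda>n. 2 * (\<Sum>i=1..m. a i * real i * x n * ((x n)\<^sup>2 + y n) ^ (i - 1))))"
proof -
  define z where "z = (\<lambda>n. (x n)\<^sup>2 + y n)"
  have z: "z \<in> lp p"
    unfolding z_def by (rule lp_square_add[OF assms])
  define B where "B = lp_norm p x"
  have xB: "\<bar>x n\<bar> \<le> B" for n
    unfolding B_def by (rule abs_le_lp_norm[OF p x])
  have B: "0 \<le> B"
    by (simp add: B_def lp_norm_nonneg)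
  \<comment> \<open>The first argument bounds the points \<open>z n\<close>, the second the increments \<open>h\<close> for \<open>\<bar>u n\<bar> \<le> 1\<close>.\<close>
  define M where "M = max (lp_norm p z) (2 * B + 1)"
  have zM: "\<bar>z n\<bar> \<le> M" for n
    using abs_le_lp_norm[OF p z, of n] by (simp add: M_def)
  define d where "d = (\<lambda>n. \<Sum>i=1..m. real i * a i * z n ^ (i - 1))"
  define K where "K = (\<Sum>i=1..m. \<bar>real i * a i\<bar> * M ^ (i - 1))"
  have dK: "\<bar>d n\<bar> \<le> K" for n
    unfolding d_def K_def by (rule polynomial_bounded[OF zM])
  have K: "0 \<le> K"
    using dK[of 0] by linarith
  obtain C where C: "0 \<le> C" "\<And>z h. \<bar>z\<bar> \<le> M \<Longrightarrow> \<bar>h\<bar> \<le> M \<Longrightarrow>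
      \<bar>(\<Sum>i=1..m. a i * (z + h) ^ i) - (\<Sum>i=1..m. a i * z ^ i)
        - (\<Sum>i=1..m. real i * a i * z ^ (i - 1)) * h\<bar> \<le> C * h\<^sup>2"
    using polynomial_quadratic_remainder[where I = "{1..m}" and a = a and M = M] by blast
  have "lp_has_derivative p (\<lambda>u n. Q m a (\<lambda>k. x k + u k) y n - Q m a x y n)
      (lp_diag p (\<lambda>n. 2 * x n * d n))"
  proof (rule lp_diag_has_derivative[OF p])
    show "\<bar>2 * x n * d n\<bar> \<le> 2 * B * K" for n
      using mult_mono[OF xB dK B] by (simp add: abs_mult)
    show "0 \<le> C * (2 * B + 1)\<^sup>2 + K"
      using C(1) K by simp
    fix u :: "nat \<Rightarrow> real" and n assume u: "\<bar>u n\<bar> \<le> 1"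
    define h where "h = 2 * x n * u n + (u n)\<^sup>2"
    have "\<bar>h\<bar> = \<bar>2 * x n + u n\<bar> * \<bar>u n\<bar>"
      by (simp add: h_def power2_eq_square algebra_simps flip: abs_mult)
    also have "\<dots> \<le> (2 * B + 1) * \<bar>u n\<bar>"
      using xB[of n] u by (intro mult_right_mono) auto
    finally have hu: "\<bar>h\<bar> \<le> (2 * B + 1) * \<bar>u n\<bar>" .
    also have "\<dots> \<le> (2 * B + 1) * 1"
      using u B by (intro mult_left_mono) auto
    finally have hM: "\<bar>h\<bar> \<le> M"
      by (simp add: M_def)
    have hsq: "h\<^sup>2 \<le> (2 * B + 1)\<^sup>2 * (u n)\<^sup>2"
      using power_mono[OF hu, of 2] by (simp add: power_mult_distrib)
    have zh: "(x n + u n)\<^sup>2 + y n = z n + h"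
      by (simp add: z_def h_def power2_sum algebra_simps)
    have "Q m a (\<lambda>k. x k + u k) y n - Q m a x y n - 2 * x n * d n * u n
        = (\<Sum>i=1..m. a i * (z n + h) ^ i) - (\<Sum>i=1..m. a i * z n ^ i) - d n * h + d n * (u n)\<^sup>2"
      unfolding Q_def zh by (simp add: z_def h_def algebra_simps)
    also have "\<bar>\<dots>\<bar> \<le> C * h\<^sup>2 + \<bar>d n\<bar> * (u n)\<^sup>2"
      using C(2)[OF zM[of n] hM] by (auto simp: d_def abs_mult intro: order_trans[OF abs_triangle_ineq])
    also have "\<dots> \<le> C * ((2 * B + 1)\<^sup>2 * (u n)\<^sup>2) + K * (u n)\<^sup>2"
      using hsq C(1) dK[of n] by (intro add_mono mult_left_mono mult_right_mono) auto
    finally show "\<bar>Q m a (\<lambda>k. x k + u k) y n - Q m a x y n - 2 * x n * d n * u n\<bar>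
        \<le> (C * (2 * B + 1)\<^sup>2 + K) * (u n)\<^sup>2"
      by (simp add: algebra_simps)
  qed
  moreover have "(\<lambda>n. 2 * x n * d n)
      = (\<lambda>n. 2 * (\<Sum>i=1..m. a i * real i * x n * ((x n)\<^sup>2 + y n) ^ (i - 1)))"
    by (simp add: d_def z_def sum_distrib_left mult_ac)
  ultimately show ?thesis
    by (simp add: lp_has_partial1_iff)
qed

lemma Q_has_partial2:
  assumes p: "0 < p" and x: "x \<in> lp p" and y: "y \<in> lp p"
  shows "lp_has_partial2 p (Q m a) x y
    (lp_diag p (\<lambda>n. \<Sum>i=1..m. real i * a i * ((x n)\<^sup>2 + y n) ^ (i - 1)))"
proof -
  define z where "z = (\<lambda>n. (x n)\<^sup>2 + y n)"
  have z: "z \<in> lp p"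
    unfolding z_def by (rule lp_square_add[OF assms])
  define M where "M = max (lp_norm p z) 1"
  have zM: "\<bar>z n\<bar> \<le> M" for n
    using abs_le_lp_norm[OF p z, of n] by (simp add: M_def)
  obtain C where C: "0 \<le> C" "\<And>z h. \<bar>z\<bar> \<le> M \<Longrightarrow> \<bar>h\<bar> \<le> M \<Longrightarrow>
      \<bar>(\<Sum>i=1..m. a i * (z + h) ^ i) - (\<Sum>i=1..m. a i * z ^ i)
        - (\<Sum>i=1..m. real i * a i * z ^ (i - 1)) * h\<bar> \<le> C * h\<^sup>2"
    using polynomial_quadratic_remainder[where I = "{1..m}" and a = a and M = M] by blast
  have "lp_has_derivative p (\<lambda>w n. Q m a x (\<lambda>k. y k + w k) n - Q m a x y n)
      (lp_diag p (\<lambda>n. \<Sum>i=1..m. real i * a i * z n ^ (i - 1)))"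
  proof (rule lp_diag_has_derivative[OF p _ _ C(1)])
    show "\<bar>\<Sum>i=1..m. real i * a i * z n ^ (i - 1)\<bar> \<le> (\<Sum>i=1..m. \<bar>real i * a i\<bar> * M ^ (i - 1))" for n
      by (rule polynomial_bounded[OF zM])
    show "\<bar>Q m a x (\<lambda>k. y k + w k) n - Q m a x y n
        - (\<Sum>i=1..m. real i * a i * z n ^ (i - 1)) * w n\<bar> \<le> C * (w n)\<^sup>2" if "\<bar>w n\<bar> \<le> 1" for w n
      using C(2)[OF zM[of n], of "w n"] that by (simp add: Q_def z_def M_def add.assoc)
  qed
  then show ?thesis
    by (simp add: lp_has_partial2_iff z_def)
qed

theorem corollary3p3:
  fixes p :: real and m :: nat and a :: "nat \<Rightarrow> real"
  assumes "1 < p" and "m \<ge> 1"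
  shows "(\<forall>x\<in>lp p. \<forall>y\<in>lp p. Q m a x y \<in> lp p) \<and>
    (\<forall>x\<in>lp p. \<forall>y\<in>lp p.
       lp_partial1_differentiable p (Q m a) x y \<and>
       lp_partial2_differentiable p (Q m a) x y \<and>
       lp_nabla1 p (Q m a) x y =
         lp_diag p (\<lambda>n. 2 * (\<Sum>i=1..m. a i * real i * x n * ((x n)\<^sup>2 + y n) ^ (i - 1))) \<and>
       lp_nabla2 p (Q m a) x y =
         lp_diag p (\<lambda>n. \<Sum>i=1..m. real i * a i * ((x n)\<^sup>2 + y n) ^ (i - 1)))"
proof -
  have p: "0 < p"
    using assms(1) by linarith
  show ?thesis
    unfolding lp_partial1_differentiable_def lp_partial2_differentiable_def
    using Q_in_lp[OF p] Q_has_partial1[OF p] Q_has_partial2[OF p]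
      lp_nabla1_eqI[OF p Q_has_partial1[OF p]] lp_nabla2_eqI[OF p Q_has_partial2[OF p]]
    by blast
qed

end
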